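(* Let $\mathfrak{g}$ be an associative complex algebra with unit and let $\mathcal{A}_k$ ($k\ge0$) be the standard polynomials on $\mathfrak{g}$. Then $$\mathcal{A}_k=\underbrace{\mathcal{A}_1\times\dots\times\mathcal{A}_1}_{k\text{ times}}\quad\text{for all }k\ge1,\qquad \mathcal{A}_k\times\mathcal{A}_\ell=\mathcal{A}_\ell\times\mathcal{A}_k=\mathcal{A}_{k+\ell}\quad\text{for all }k,\ell\ge0.$$
   Context: $\mathcal{M}_a^0(\mathfrak{g})=\mathfrak{g}$ and, for $k\ge1$, $\mathcal{M}_a^k(\mathfrak{g})$ is the space of skew symmetric $k$-linear maps $\mathfrak{g}^k\to\mathfrak{g}$; $\mathcal{M}_a(\mathfrak{g})=\sum_{k\ge0}\mathcal{M}_a^k(\mathfrak{g})$. $\mathfrak{S}_{p,q}$ is the set of permutations $\sigma\in\mathfrak{S}_{p+q}$ with $\sigma(1)<\dots<\sigma(p)$ and $\sigma(p+1)<\dots<\sigma(p+q)$; $\varepsilon(\sigma)$ is the signature. The associative product $\times$ on $\mathcal{M}_a(\mathfrak{g})$ is defined, for $F\in\mathcal{M}_a^p(\mathfrak{g})$, $G\in\mathcal{M}_a^q(\mathfrak{g})$, by $$(F\times G)(Y_1,\dots,Y_{p+q})=\sum_{\sigma\in\mathfrak{S}_{p,q}}\varepsilon(\sigma)\,F(Y_{\sigma(1)},\dots,Y_{\sigma(p)})\cdot G(Y_{\sigma(p+1)},\dots,Y_{\sigma(p+q)}),$$ where $\cdot$ is the product of $\mathfrak{g}$. Standard polynomials: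 $\mathcal{A}_0=\mathbf{1}$ (the unit of $\mathfrak{g}$), and for $k\ge1$, $\mathcal{A}_k(Y_1,\dots,Y_k)=\sum_{\sigma\in\mathfrak{S}_k}\varepsilon(\sigma)\,Y_{\sigma(1)}\cdots Y_{\sigma(k)}$; so $\mathcal{A}_1=\mathrm{Id}_{\mathfrak{g}}$. *)

theory Defs
  imports Complex_Main "HOL-Combinatorics.Permutations"
begin

text \<open>
  An associative complex algebra with unit on a type. The sort is \<open>{ring, monoid_mult}\<close> rather than
  \<open>ring_1\<close> because the latter contains \<open>0 \<noteq> 1\<close> and would exclude the zero algebra.
\<close>

locale complex_unital_algebra = vector_space scale
  for scale :: "complex \<Rightarrow> 'g \<Rightarrow> 'g::{ring, monoid_mult}" +
  assumes mult_scale_left: "scale c x * y = scale c (x * y)"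
    and mult_scale_right: "x * scale c y = scale c (x * y)"

text \<open>
  Arguments \<open>(Y\<^sub>1, \<dots>, Y\<^sub>k)\<close> are lists of length \<open>k\<close>, and a permutation acts on the positions
  \<open>0, \<dots>, k - 1\<close>. A \<open>k\<close>-linear map is a function on lists that is \<open>0\<close> on lists of any length other
  than \<open>k\<close>, so that equality of functions is equality of maps of the same degree (up to the zero
  map, which belongs to every degree). For \<open>k = 0\<close> such a map is its value at \<open>[]\<close>. An element of
  the direct sum over all degrees is a function on lists whose component of degree \<open>k\<close> is its
  restriction to lists of length \<open>k\<close>.
\<close>

definition permute_args :: "(nat \<Rightarrow> nat) \<Rightarrow> 'g list \<Rightarrow> 'g list" where
  "permute_args \<sigma> Ys = map (\<lambda>i. Ys ! \<sigma> i) [0..<length Ys]"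

definition skew_maps :: "(complex \<Rightarrow> 'g \<Rightarrow> 'g) \<Rightarrow> nat \<Rightarrow> ('g list \<Rightarrow> 'g::{ring, monoid_mult}) set" where
  "skew_maps scale k = {F.
     (\<forall>Ys. length Ys \<noteq> k \<longrightarrow> F Ys = 0) \<and>
     (\<forall>Ys i. length Ys = k \<and> i < k \<longrightarrow> Vector_Spaces.linear scale scale (\<lambda>y. F (Ys[i := y]))) \<and>
     (\<forall>Ys \<sigma>. length Ys = k \<and> \<sigma> permutes {..<k} \<longrightarrow>
        F (permute_args \<sigma> Ys) = scale (of_int (sign \<sigma>)) (F Ys))}"

definition shuffle_perms :: "nat \<Rightarrow> nat \<Rightarrow> (nat \<Rightarrow> nat) set" where
  "shuffle_perms p q = {\<sigma>. \<sigma> permutes {..<p + q} \<and>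
     strict_mono_on {..<p} \<sigma> \<and> strict_mono_on {p..<p + q} \<sigma>}"

definition shuffle_sum ::
  "(complex \<Rightarrow> 'g \<Rightarrow> 'g) \<Rightarrow> nat \<Rightarrow> nat \<Rightarrow> ('g list \<Rightarrow> 'g) \<Rightarrow> ('g list \<Rightarrow> 'g) \<Rightarrow>
     'g list \<Rightarrow> 'g::{ring, monoid_mult}" where
  "shuffle_sum scale p q F G Ys = (\<Sum>\<sigma>\<in>shuffle_perms p q.
     scale (of_int (sign \<sigma>))
       (F (map (\<lambda>i. Ys ! \<sigma> i) [0..<p]) * G (map (\<lambda>i. Ys ! \<sigma> i) [p..<p + q])))"

text \<open>
  The product \<open>\<times>\<close>, extended biadditively from homogeneous maps: in degree \<open>n\<close> it collects the
  products of the components of degrees \<open>p\<close> and \<open>q\<close> over all \<open>p + q = n\<close>. For homogeneous factors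
  only one summand survives, see \<open>cross_homogeneous\<close>.
\<close>

definition cross ::
  "(complex \<Rightarrow> 'g \<Rightarrow> 'g) \<Rightarrow> ('g list \<Rightarrow> 'g) \<Rightarrow> ('g list \<Rightarrow> 'g) \<Rightarrow>
     'g list \<Rightarrow> 'g::{ring, monoid_mult}" where
  "cross scale F G Ys = (\<Sum>p\<le>length Ys. shuffle_sum scale p (length Ys - p) F G Ys)"

text \<open>\<open>F \<times> \<dots> \<times> F\<close> with \<open>k \<ge> 1\<close> factors, bracketed to the left; not meant for \<open>k = 0\<close>.\<close>

definition cross_power ::
  "(complex \<Rightarrow> 'g \<Rightarrow> 'g) \<Rightarrow> ('g list \<Rightarrow> 'g) \<Rightarrow> nat \<Rightarrow> 'g list \<Rightarrow> 'g::{ring, monoid_mult}" where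
  "cross_power scale F k = foldl (cross scale) F (replicate (k - 1) F)"

text \<open>The case \<open>k = 0\<close> is covered by the general formula, see \<open>standard_poly_0\<close>.\<close>

definition standard_poly ::
  "(complex \<Rightarrow> 'g \<Rightarrow> 'g) \<Rightarrow> nat \<Rightarrow> 'g list \<Rightarrow> 'g::{ring, monoid_mult}" where
  "standard_poly scale k Ys =
     (if length Ys = k
      then \<Sum>\<sigma> | \<sigma> permutes {..<k}.
             scale (of_int (sign \<sigma>)) (prod_list (map (\<lambda>i. Ys ! \<sigma> i) [0..<k]))
      else 0)"

lemma (in complex_unital_algebra) cross_homogeneous:
  assumes F: "F \<in> skew_maps scale p" and G: "G \<in> skew_maps scale q"
  shows "cross scale F G Ys = (if length Ys = p + q then shuffle_sum scale p q F G Ys else 0)"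
proof -
  have F0: "F Zs = 0" if "length Zs \<noteq> p" for Zs
    using F that by (simp add: skew_maps_def)
  have G0: "G Zs = 0" if "length Zs \<noteq> q" for Zs
    using G that by (simp add: skew_maps_def)
  have z: "shuffle_sum scale p' (length Ys - p') F G Ys = 0"
    if "p' \<noteq> p \<or> length Ys - p' \<noteq> q" for p'
    unfolding shuffle_sum_def using that
    by (intro sum.neutral ballI) (cases "p' = p"; simp add: F0 G0)
  show ?thesis
  proof (cases "length Ys = p + q")
    case True
    have "cross scale F G Ys = (\<Sum>p'\<in>{p}. shuffle_sum scale p' (length Ys - p') F G Ys)"
      unfolding cross_def by (rule sum.mono_neutral_right) (use True z in auto)
    then show ?thesis using True by simp
  next
    case False
    have "cross scale F G Ys = 0"
      unfolding cross_def
    proof (intro sum.neutral ballI z)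
      fix p' assume "p' \<in> {..length Ys}"
      then show "p' \<noteq> p \<or> length Ys - p' \<noteq> q" using False by auto
    qed
    then show ?thesis using False by simp
  qed
qed

lemma (in complex_unital_algebra) standard_poly_0:
  "standard_poly scale 0 Ys = (if Ys = [] then 1 else 0)"
  by (simp add: standard_poly_def)

lemma (in complex_unital_algebra) standard_poly_1:
  "standard_poly scale 1 [y] = y"
proof -
  have "{\<sigma>. \<sigma> permutes {..<Suc 0}} = {id}"
    by (simp add: lessThan_Suc)
  then show ?thesis by (simp add: standard_poly_def)
qed

lemma (in complex_unital_algebra) standard_poly_skew:
  "standard_poly scale k \<in> skew_maps scale k"
proof -
  have lin: "Vector_Spaces.linear scale scale (\<lambda>y. standard_poly scale k (Ys[j := y]))"
    if Ys: "length Ys = k" and j: "j < k" for Ys j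
  proof -
    have prod_form: "\<exists>a b. \<forall>y. prod_list (map (\<lambda>i. Ys[j := y] ! \<sigma> i) [0..<k]) = a * y * b"
      if s: "\<sigma> permutes {..<k}" for \<sigma>
    proof -
      obtain m where m: "m < k" "\<sigma> m = j"
        using permutes_image[OF s] j by (metis imageE lessThan_iff)
      have split: "[0..<k] = [0..<m] @ m # [Suc m..<k]"
        using m(1) by (metis upt_add_eq_append upt_conv_Cons le_add_diff_inverse less_imp_le_nat zero_le)
      have ne: "\<sigma> i \<noteq> j" if "i \<noteq> m" for i
        using that m(2) permutes_inj[OF s] by (metis injD)
      have eq: "map (\<lambda>i. Ys[j := y] ! \<sigma> i) [0..<m] = map (\<lambda>i. Ys ! \<sigma> i) [0..<m]"
        "map (\<lambda>i. Ys[j := y] ! \<sigma> i) [Suc m..<k] = map (\<lambda>i. Ys ! \<sigma> i) [Suc m..<k]" for y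
        by (auto simp: ne[symmetric] intro!: nth_list_update_neq)
      have "prod_list (map (\<lambda>i. Ys[j := y] ! \<sigma> i) [0..<k]) =
          prod_list (map (\<lambda>i. Ys ! \<sigma> i) [0..<m]) * y * prod_list (map (\<lambda>i. Ys ! \<sigma> i) [Suc m..<k])" for y
        unfolding split map_append list.map eq using m(2) Ys j
        by (simp add: mult.assoc)
      then show ?thesis by blast
    qed
    define P where "P \<sigma> y = prod_list (map (\<lambda>i. Ys[j := y] ! \<sigma> i) [0..<k])" for \<sigma> y
    have P: "P \<sigma> (x + y) = P \<sigma> x + P \<sigma> y \<and> P \<sigma> (scale c x) = scale c (P \<sigma> x)"
      if s: "\<sigma> permutes {..<k}" for \<sigma> x y c
    proof -
      obtain a b where "\<And>y. P \<sigma> y = a * y * b" using prod_form[OF s] P_def by auto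
      then show ?thesis by (simp add: algebra_simps mult_scale_left mult_scale_right)
    qed
    have A: "standard_poly scale k (Ys[j := y]) =
        (\<Sum>\<sigma> | \<sigma> permutes {..<k}. scale (of_int (sign \<sigma>)) (P \<sigma> y))" for y
      by (simp add: standard_poly_def P_def Ys)
    show ?thesis
      unfolding A
      by unfold_locales
        (simp_all add: P scale_right_distrib sum.distrib scale_sum_right mult.commute)
  qed
  have skew: "standard_poly scale k (permute_args \<tau> Ys)
      = scale (of_int (sign \<tau>)) (standard_poly scale k Ys)"
    if Ys: "length Ys = k" and t: "\<tau> permutes {..<k}" for Ys \<tau>
  proof -
    define f where "f \<sigma> = prod_list (map (\<lambda>i. Ys ! \<sigma> i) [0..<k])" for \<sigma>
    have nth: "permute_args \<tau> Ys ! \<sigma> i = Ys ! (\<tau> \<circ> \<sigma>) i"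
      if "\<sigma> permutes {..<k}" "i < k" for \<sigma> i
      using permutes_in_image[OF that(1), of i] that(2) by (simp add: permute_args_def Ys)
    have "standard_poly scale k (permute_args \<tau> Ys)
        = (\<Sum>\<sigma> | \<sigma> permutes {..<k}. scale (of_int (sign \<sigma>)) (f (\<tau> \<circ> \<sigma>)))"
      unfolding standard_poly_def f_def
      by (auto simp: permute_args_def[of _ Ys, THEN arg_cong, of length] Ys nth
          intro!: sum.cong arg_cong[where f = prod_list] arg_cong[where f = "scale _"] map_cong)
    also have "\<dots> = (\<Sum>\<sigma> | \<sigma> permutes {..<k}.
        scale (of_int (sign \<tau>)) (scale (of_int (sign (\<tau> \<circ> \<sigma>))) (f (\<tau> \<circ> \<sigma>))))"
    proof (rule sum.cong)
      fix \<sigma> assume "\<sigma> \<in> {\<sigma>. \<sigma> permutes {..<k}}"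
      then have s: "\<sigma> permutes {..<k}" by simp
      have "sign (\<tau> \<circ> \<sigma>) = sign \<tau> * sign \<sigma>"
        using s t by (intro sign_compose) (auto simp: permutation_permutes)
      then have "sign \<tau> * sign (\<tau> \<circ> \<sigma>) = sign \<sigma>"
        by (simp add: sign_def)
      then have "of_int (sign \<sigma>) = (of_int (sign \<tau>) * of_int (sign (\<tau> \<circ> \<sigma>)) :: complex)"
        by (metis of_int_mult)
      then show "scale (of_int (sign \<sigma>)) (f (\<tau> \<circ> \<sigma>)) =
          scale (of_int (sign \<tau>)) (scale (of_int (sign (\<tau> \<circ> \<sigma>))) (f (\<tau> \<circ> \<sigma>)))"
        by (simp only: scale_scale)
    qed simp
    also have "\<dots> = (\<Sum>\<sigma> | \<sigma> permutes {..<k}.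
        scale (of_int (sign \<tau>)) (scale (of_int (sign \<sigma>)) (f \<sigma>)))"
      by (rule setum_permutations_compose_left[symmetric, OF t])
    also have "\<dots> = scale (of_int (sign \<tau>)) (standard_poly scale k Ys)"
      by (simp add: standard_poly_def f_def Ys scale_sum_right)
    finally show ?thesis .
  qed
  show ?thesis
    unfolding skew_maps_def using lin skew by (auto simp: standard_poly_def)
qed

end

theory Submission
  imports Defs "HOL-Library.Infinite_Set"
begin

text \<open>
  Every permutation of \<open>{..<p + q}\<close> factors uniquely as \<open>\<sigma> \<circ> \<alpha> \<circ> \<beta>\<close> with a shuffle \<open>\<sigma>\<close>, a permutation
  \<open>\<alpha>\<close> of the first \<open>p\<close> positions and a permutation \<open>\<beta>\<close> of the last \<open>q\<close>. Expanding both standard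
  polynomials in the shuffle sum and collecting the terms along this factorization gives
  \<open>\<A>\<^sub>p \<times> \<A>\<^sub>q = \<A>\<^bsub>p+q\<^esub>\<close>; commutativity and the power formula follow at once.
\<close>

section \<open>Shuffles and subsets of the positions\<close>

text \<open>Induction on \<open>x\<close>: if \<open>f\<close> and \<open>g\<close> agree below
  \<open>x\<close>, the smaller of their values at \<open>x\<close> could not be attained by the
  other function, although the images coincide. This gives the uniqueness of increasing
  enumerations.\<close>

lemma strict_mono_on_eqI:
  fixes f g :: "'a::wellorder \<Rightarrow> 'b::linorder"
  assumes f: "strict_mono_on A f" and g: "strict_mono_on A g" and im: "f ` A = g ` A" and "x \<in> A"
  shows "f x = g x"
  using \<open>x \<in> A\<close>
proof (induction x rule: less_induct)
  case (less x)
  have not_less: "\<not> u x < v x"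
    if u: "strict_mono_on A u" and v: "strict_mono_on A v" and "u ` A = v ` A"
      and IH: "\<And>y. y < x \<Longrightarrow> y \<in> A \<Longrightarrow> u y = v y" for u v :: "'a \<Rightarrow> 'b"
  proof
    assume lt: "u x < v x"
    obtain y where y: "y \<in> A" "u x = v y"
      using \<open>u ` A = v ` A\<close> less.prems by (metis imageE imageI)
    \<comment> \<open>An earlier \<open>y\<close> would give \<open>u y = u x\<close> by
      \<open>IH\<close>, against monotonicity of \<open>u\<close>; a later one would give
      \<open>v x < v y = u x\<close>, against \<open>lt\<close>.\<close>
    consider "y < x" | "y = x" | "x < y" by fastforce
    then show False
    proof cases
      case 1
      then show False using IH y less.prems strict_mono_onD[OF u, of y x] by simp
    next
      case 3
      then show False using y lt less.prems strict_mono_onD[OF v, of x y] by simp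
    qed (use lt y in simp)
  qed
  show ?case
    using not_less[OF f g im] not_less[OF g f im[symmetric]] less.IH by (metis linorder_less_linear)
qed

text \<open>The image of the first block fixes that of the second, its complement, and on each block
  a shuffle is the increasing enumeration of its image.\<close>

lemma shuffle_perm_eqI:
  assumes s: "\<sigma> \<in> shuffle_perms p q" and t: "\<tau> \<in> shuffle_perms p q"
    and im: "\<sigma> ` {..<p} = \<tau> ` {..<p}"
  shows "\<sigma> = \<tau>"
proof
  fix i
  have sp: "\<sigma> permutes {..<p + q}" and tp: "\<tau> permutes {..<p + q}"
    using s t by (auto simp: shuffle_perms_def)
  have split: "{p..<p + q} = {..<p + q} - {..<p}" by auto
  have "\<sigma> ` {p..<p + q} = \<tau> ` {p..<p + q}"
    unfolding split
    by (simp only: image_set_diff[OF permutes_inj[OF sp]] image_set_diff[OF permutes_inj[OF tp]]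
        permutes_image[OF sp] permutes_image[OF tp] im)
  then have "\<sigma> i = \<tau> i" if "i \<in> {p..<p + q}"
    using s t that by (intro strict_mono_on_eqI[of "{p..<p + q}"]) (auto simp: shuffle_perms_def)
  moreover have "\<sigma> i = \<tau> i" if "i \<in> {..<p}"
    using s t that im by (intro strict_mono_on_eqI[of "{..<p}"]) (auto simp: shuffle_perms_def)
  moreover have "\<sigma> i = \<tau> i" if "i \<notin> {..<p + q}"
    using permutes_not_in[OF sp that] permutes_not_in[OF tp that] by simp
  ultimately show "\<sigma> i = \<tau> i" by fastforce
qed

lemma bij_betw_diff_nat: "bij_betw (\<lambda>i. i - p) {p..<p + q} {..<q :: nat}"
  by (rule bij_betw_byWitness[where f' = "(+) p"]) auto

text \<open>Enumerating \<open>S\<close> and then its complement increasingly yields the shuffle.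
  With \<open>shuffle_perm_eqI\<close>, shuffles thus correspond to the \<open>p\<close>-element
  subsets of the positions.\<close>

lemma exists_shuffle_perm:
  assumes S: "S \<subseteq> {..<p + q}" and card: "card S = p"
  shows "\<exists>\<sigma>\<in>shuffle_perms p q. \<sigma> ` {..<p} = S"
proof -
  define T where "T = {..<p + q} - S"
  have fin: "finite S" "finite T" using S finite_subset by (auto simp: T_def)
  have cT: "card T = q"
    using S card fin(1) by (simp add: T_def card_Diff_subset)
  obtain f where f: "f ` {..<p} = S" "strict_mono_on {..<p} f"
    using ex_bij_betw_strict_mono_card[OF fin(1)] by (metis bij_betw_imp_surj_on card)
  obtain g where g: "g ` {..<q} = T" "strict_mono_on {..<q} g"
    using ex_bij_betw_strict_mono_card[OF fin(2)] by (metis bij_betw_imp_surj_on cT)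
  define \<sigma> where "\<sigma> i = (if i < p then f i else if i < p + q then g (i - p) else i)" for i
  have im1: "\<sigma> ` {..<p} = S"
    using f(1) by (auto simp: \<sigma>_def image_iff)
  have "(\<lambda>i. i - p) ` {p..<p + q} = {..<q}"
    using bij_betw_imp_surj_on[OF bij_betw_diff_nat] by simp
  then have "(\<lambda>i. g (i - p)) ` {p..<p + q} = T"
    using g(1) by (metis image_image)
  then have im2: "\<sigma> ` {p..<p + q} = T"
    by (simp add: \<sigma>_def cong: image_cong_simp)
  have "{..<p + q} = {..<p} \<union> {p..<p + q}" by auto
  \<comment> \<open>Surjectivity suffices: on a finite set it implies injectivity.\<close>
  then have im: "\<sigma> ` {..<p + q} = {..<p + q}"
    using S by (simp only: image_Un im1 im2) (auto simp: T_def)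
  have "\<sigma> permutes {..<p + q}"
  proof (rule bij_imp_permutes)
    show "bij_betw \<sigma> {..<p + q} {..<p + q}"
      using im by (simp add: bij_betw_def eq_card_imp_inj_on)
  qed (simp add: \<sigma>_def)
  moreover have "strict_mono_on {..<p} \<sigma>"
    by (intro strict_mono_onI) (auto simp: \<sigma>_def intro!: strict_mono_onD[OF f(2)])
  moreover have "strict_mono_on {p..<p + q} \<sigma>"
    by (intro strict_mono_onI) (auto simp: \<sigma>_def intro!: strict_mono_onD[OF g(2)])
  ultimately show ?thesis using im1 by (auto simp: shuffle_perms_def)
qed

section \<open>Factorization of permutations into shuffles and block permutations\<close>

text \<open>Each factor fixes the block of the other, and \<beta> never moves a point across
  \<open>p\<close>. The second case includes the points from \<open>p + q\<close> on, which both
  factors fix.\<close>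

lemma block_perm_eval:
  fixes p q :: nat
  assumes a: "\<alpha> permutes {..<p}" and b: "\<beta> permutes {p..<p + q}"
  shows "i < p \<Longrightarrow> (\<alpha> \<circ> \<beta>) i = \<alpha> i" "p \<le> i \<Longrightarrow> (\<alpha> \<circ> \<beta>) i = \<beta> i"
proof -
  show "(\<alpha> \<circ> \<beta>) i = \<alpha> i" if "i < p"
    using that by (simp add: permutes_not_in[OF b, of i])
  show "(\<alpha> \<circ> \<beta>) i = \<beta> i" if "p \<le> i"
  proof -
    have "p \<le> \<beta> i"
      using permutes_in_image[OF b, of i] permutes_not_in[OF b, of i] that by fastforce
    then show ?thesis by (simp add: permutes_not_in[OF a])
  qed
qed

text \<open>The image of \<open>{..<p}\<close> under \<pi> determines the shuffle \<sigma>. What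
  remains, \<open>inv \<sigma> \<circ> \<pi>\<close>, preserves both blocks and is therefore a
  unique product of a permutation of each.\<close>

lemma bij_betw_shuffle_block:
  "bij_betw (\<lambda>(\<sigma>, \<alpha>, \<beta>). \<sigma> \<circ> (\<alpha> \<circ> \<beta>))
     (shuffle_perms p q \<times> {\<alpha>. \<alpha> permutes {..<p}} \<times> {\<beta>. \<beta> permutes {p..<p + q}})
     {\<pi>. \<pi> permutes {..<p + q}}"
  (is "bij_betw ?f ?D ?P")
proof (rule bij_betw_imageI)
  show "inj_on ?f ?D"
  proof (rule inj_onI)
    fix x x' assume "x \<in> ?D" "x' \<in> ?D" and f_eq: "?f x = ?f x'"
    then obtain \<sigma> \<alpha> \<beta> \<sigma>' \<alpha>' \<beta>'
      where x: "x = (\<sigma>, \<alpha>, \<beta>)" "x' = (\<sigma>', \<alpha>', \<beta>')" and s: "\<sigma> \<in> shuffle_perms p q" and a: "\<alpha> permutes {..<p}" and b: "\<beta> permutes {p..<p + q}"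
      and s': "\<sigma>' \<in> shuffle_perms p q" and a': "\<alpha>' permutes {..<p}" and b': "\<beta>' permutes {p..<p + q}"
      by blast
    have eq: "\<sigma> \<circ> (\<alpha> \<circ> \<beta>) = \<sigma>' \<circ> (\<alpha>' \<circ> \<beta>')"
      using f_eq by (simp only: x prod.case)
    \<comment> \<open>Block permutations do not change the image of the first block, so this image
      recovers the shuffle from the composite.\<close>
    have im: "(\<tau> \<circ> (\<gamma> \<circ> \<delta>)) ` {..<p} = \<tau> ` {..<p}"
      if c: "\<gamma> permutes {..<p}" and d: "\<delta> permutes {p..<p + q}" for \<tau> \<gamma> \<delta> :: "nat \<Rightarrow> nat"
    proof -
      have "(\<gamma> \<circ> \<delta>) ` {..<p} = \<gamma> ` {..<p}"
        using block_perm_eval(1)[OF c d] by (intro image_cong) auto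
      then show ?thesis by (simp only: image_comp[symmetric] permutes_image[OF c])
    qed
    have [simp]: "\<sigma> = \<sigma>'"
      using im[OF a b, of \<sigma>] im[OF a' b', of \<sigma>'] eq by (intro shuffle_perm_eqI[OF s s']) simp
    have "inj \<sigma>'" using s' by (auto simp: shuffle_perms_def intro: permutes_inj)
    then have ab: "\<alpha> \<circ> \<beta> = \<alpha>' \<circ> \<beta>'"
      using eq by (simp add: fun_eq_iff inj_eq)
    have "\<alpha> i = \<alpha>' i" for i
      using block_perm_eval(1)[OF a b, of i] block_perm_eval(1)[OF a' b', of i] ab
        permutes_not_in[OF a, of i] permutes_not_in[OF a', of i] by (cases "i < p") auto
    moreover have "\<beta> i = \<beta>' i" for i
      using block_perm_eval(2)[OF a b, of i] block_perm_eval(2)[OF a' b', of i] ab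
        permutes_not_in[OF b, of i] permutes_not_in[OF b', of i] by (cases "p \<le> i") auto
    ultimately show "x = x'" by (simp add: x fun_eq_iff)
  qed
next
  show "?f ` ?D = ?P"
  proof (intro equalityI subsetI)
    fix \<pi> assume "\<pi> \<in> ?f ` ?D"
    then obtain \<sigma> \<alpha> \<beta> where "\<sigma> permutes {..<p + q}" "\<alpha> permutes {..<p}" "\<beta> permutes {p..<p + q}"
      "\<pi> = \<sigma> \<circ> (\<alpha> \<circ> \<beta>)" by (auto simp: shuffle_perms_def)
    moreover from this have "\<alpha> permutes {..<p + q}"
      by (elim permutes_subset) simp
    moreover from calculation have "\<beta> permutes {..<p + q}"
      by (auto elim: permutes_subset[where S = "{p..<p + q}"])
    ultimately show "\<pi> \<in> ?P" by (simp add: permutes_compose)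
  next
    fix \<pi> assume "\<pi> \<in> ?P"
    then have pi: "\<pi> permutes {..<p + q}" by simp
    have "\<pi> ` {..<p} \<subseteq> {..<p + q}"
      using image_mono[of "{..<p}" "{..<p + q}" \<pi>] by (simp add: permutes_image[OF pi])
    moreover have "card (\<pi> ` {..<p}) = p"
      by (simp add: card_image permutes_inj_on[OF pi])
    ultimately obtain \<sigma> where s: "\<sigma> \<in> shuffle_perms p q" and im: "\<sigma> ` {..<p} = \<pi> ` {..<p}"
      using exists_shuffle_perm[of "\<pi> ` {..<p}" p q] by blast
    have sp: "\<sigma> permutes {..<p + q}" using s by (simp add: shuffle_perms_def)
    \<comment> \<open>As \<sigma> and \<pi> have the same image of \<open>{..<p}\<close>, this
      quotient maps each block onto itself; its restrictions are the two block factors.\<close>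
    define \<rho> where "\<rho> = inv \<sigma> \<circ> \<pi>"
    have rp: "\<rho> permutes {..<p + q}"
      unfolding \<rho>_def by (intro permutes_compose pi permutes_inv sp)
    have "\<rho> ` {..<p} = inv \<sigma> ` \<sigma> ` {..<p}"
      by (simp only: \<rho>_def im image_comp[symmetric])
    then have r1: "\<rho> ` {..<p} = {..<p}"
      by (simp only: image_inv_f_f permutes_inj[OF sp])
    have "{p..<p + q} = {..<p + q} - {..<p}" by auto
    then have r2: "\<rho> ` {p..<p + q} = {p..<p + q}"
      by (simp only: image_set_diff[OF permutes_inj[OF rp]] r1 permutes_image[OF rp])
    define \<alpha> where "\<alpha> i = (if i \<in> {..<p} then \<rho> i else i)" for i
    define \<beta> where "\<beta> i = (if i \<in> {p..<p + q} then \<rho> i else i)" for i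
    have "bij_betw \<alpha> {..<p} {..<p} = bij_betw \<rho> {..<p} {..<p}"
      by (rule bij_betw_cong) (simp add: \<alpha>_def)
    then have a: "\<alpha> permutes {..<p}"
      using r1 permutes_inj_on[OF rp]
      by (intro bij_imp_permutes) (auto simp: bij_betw_def \<alpha>_def)
    have "bij_betw \<beta> {p..<p + q} {p..<p + q} = bij_betw \<rho> {p..<p + q} {p..<p + q}"
      by (rule bij_betw_cong) (simp add: \<beta>_def)
    then have b: "\<beta> permutes {p..<p + q}"
      using r2 permutes_inj_on[OF rp]
      by (intro bij_imp_permutes) (auto simp: bij_betw_def \<beta>_def)
    have "(\<alpha> \<circ> \<beta>) i = \<rho> i" for i
      using block_perm_eval[OF a b, of i] permutes_not_in[OF rp, of i]
      by (cases "i < p") (auto simp: \<alpha>_def \<beta>_def)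
    then have "\<pi> = \<sigma> \<circ> (\<alpha> \<circ> \<beta>)"
      by (simp add: fun_eq_iff \<rho>_def permutes_inverses[OF sp])
    then show "\<pi> \<in> ?f ` ?D"
      using s a b by (intro image_eqI[of _ _ "(\<sigma>, \<alpha>, \<beta>)"]) auto
  qed
qed

section \<open>Products of standard polynomials\<close>

context complex_unital_algebra
begin

text \<open>Conjugation by the shift \<open>(+) p\<close> carries permutations of
  \<open>{..<q}\<close> to those of \<open>{p..<p + q}\<close> and keeps the sign. This puts the
  second factor of a shuffle sum into the form that the factorization needs.\<close>

lemma standard_poly_map_upt:
  "standard_poly scale q (map y [p..<p + q]) =
     (\<Sum>\<beta> | \<beta> permutes {p..<p + q}.
        scale (of_int (sign \<beta>)) (prod_list (map (\<lambda>i. y (\<beta> i)) [p..<p + q])))"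
proof -
  define m where "m \<beta> = prod_list (map (\<lambda>i. y (\<beta> i)) [p..<p + q])" for \<beta>
  let ?up = "map_permutation {..<q} ((+) p)"
  let ?down = "map_permutation {p..<p + q} (\<lambda>i. i - p)"
  have bij: "bij_betw ((+) p) {..<q} {p..<p + q}"
    by (rule bij_betw_byWitness[where f' = "\<lambda>i. i - p"]) auto
  have summand: "m (?up \<beta>) = prod_list (map (\<lambda>i. map y [p..<p + q] ! \<beta> i) [0..<q])"
    if b: "\<beta> permutes {..<q}" for \<beta>
  proof -
    have "[p..<p + q] = map ((+) p) [0..<q]"
      by (rule nth_equalityI) simp_all
    then have "m (?up \<beta>) = prod_list (map (\<lambda>i. y (?up \<beta> (p + i))) [0..<q])"
      by (simp add: m_def o_def)
    also have "\<dots> = prod_list (map (\<lambda>i. map y [p..<p + q] ! \<beta> i) [0..<q])"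
      using permutes_in_image[OF b]
      by (intro arg_cong[where f = prod_list] map_cong refl) (simp add: map_permutation_apply)
    finally show ?thesis .
  qed
  have "(\<Sum>\<beta> | \<beta> permutes {..<q}. scale (of_int (sign \<beta>))
        (prod_list (map (\<lambda>i. map y [p..<p + q] ! \<beta> i) [0..<q])))
      = (\<Sum>\<beta> | \<beta> permutes {p..<p + q}. scale (of_int (sign \<beta>)) (m \<beta>))"
  proof (rule sum.reindex_bij_witness[where i = ?down and j = ?up]; unfold mem_Collect_eq)
    fix \<beta> assume b: "\<beta> permutes {..<q}"
    show "?down (?up \<beta>) = \<beta>"
      by (rule map_permutation_compose_inv[OF bij b]) simp
    show "?up \<beta> permutes {p..<p + q}"
      by (rule map_permutation_permutes[OF bij b])
    show "scale (of_int (sign (?up \<beta>))) (m (?up \<beta>)) =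
        scale (of_int (sign \<beta>)) (prod_list (map (\<lambda>i. map y [p..<p + q] ! \<beta> i) [0..<q]))"
      using b by (simp add: summand sign_map_permutation)
  next
    fix \<beta> assume b: "\<beta> permutes {p..<p + q}"
    show "?up (?down \<beta>) = \<beta>"
      by (rule map_permutation_compose_inv[OF bij_betw_diff_nat b]) simp
    show "?down \<beta> permutes {..<q}"
      by (rule map_permutation_permutes[OF bij_betw_diff_nat b])
  qed
  then show ?thesis by (simp add: standard_poly_def m_def)
qed

text \<open>Signs multiply and the two words concatenate, so each triple contributes exactly the
  term of the permutation it composes to; \<open>bij_betw_shuffle_block\<close> then reindexes the
  sum.\<close>

lemma shuffle_sum_standard_poly:
  assumes "length Ys = p + q"
  shows "shuffle_sum scale p q (standard_poly scale p) (standard_poly scale q) Ys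
    = standard_poly scale (p + q) Ys"
proof -
  define m where "m \<pi> i j = prod_list (map (\<lambda>k. Ys ! \<pi> k) [i..<j])" for \<pi> i j
  let ?A = "{\<alpha>. \<alpha> permutes {..<p}}" and ?B = "{\<beta>. \<beta> permutes {p..<p + q}}"
  have summand: "scale (of_int (sign \<sigma>)) (scale (of_int (sign \<alpha>)) (m (\<sigma> \<circ> \<alpha>) 0 p) *
        scale (of_int (sign \<beta>)) (m (\<sigma> \<circ> \<beta>) p (p + q)))
      = scale (of_int (sign (\<sigma> \<circ> (\<alpha> \<circ> \<beta>)))) (m (\<sigma> \<circ> (\<alpha> \<circ> \<beta>)) 0 (p + q))"
    if s: "\<sigma> \<in> shuffle_perms p q" and a: "\<alpha> permutes {..<p}" and b: "\<beta> permutes {p..<p + q}" for \<sigma> \<alpha> \<beta>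
  proof -
    have perm: "permutation \<sigma>" "permutation \<alpha>" "permutation \<beta>"
      using s a b by (auto simp: shuffle_perms_def permutation_permutes)
    have "m (\<sigma> \<circ> (\<alpha> \<circ> \<beta>)) 0 p = m (\<sigma> \<circ> \<alpha>) 0 p"
      unfolding m_def using block_perm_eval(1)[OF a b]
      by (intro arg_cong[where f = prod_list] map_cong) auto
    moreover have "m (\<sigma> \<circ> (\<alpha> \<circ> \<beta>)) p (p + q) = m (\<sigma> \<circ> \<beta>) p (p + q)"
      unfolding m_def using block_perm_eval(2)[OF a b]
      by (intro arg_cong[where f = prod_list] map_cong) auto
    moreover have "m \<pi> 0 (p + q) = m \<pi> 0 p * m \<pi> p (p + q)" for \<pi>
      by (simp add: m_def upt_add_eq_append[of 0 p q])
    moreover have "sign (\<sigma> \<circ> (\<alpha> \<circ> \<beta>)) = sign \<sigma> * (sign \<alpha> * sign \<beta>)"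
      using perm by (simp add: sign_compose permutation_compose)
    ultimately show ?thesis
      by (simp add: mult_scale_left mult_scale_right)
  qed
  have "shuffle_sum scale p q (standard_poly scale p) (standard_poly scale q) Ys
      = (\<Sum>\<sigma>\<in>shuffle_perms p q. \<Sum>\<alpha>\<in>?A. \<Sum>\<beta>\<in>?B.
          scale (of_int (sign \<sigma>)) (scale (of_int (sign \<alpha>)) (m (\<sigma> \<circ> \<alpha>) 0 p) *
            scale (of_int (sign \<beta>)) (m (\<sigma> \<circ> \<beta>) p (p + q))))"
    \<comment> \<open>The instance with offset 0 expands the first factor, the general form the
      second.\<close>
    unfolding shuffle_sum_def standard_poly_map_upt standard_poly_map_upt[of p _ 0, unfolded add_0]
    by (simp add: m_def sum_product scale_sum_right flip: lessThan_atLeast0)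
  also have "\<dots> = (\<Sum>\<sigma>\<in>shuffle_perms p q. \<Sum>\<alpha>\<in>?A. \<Sum>\<beta>\<in>?B.
      scale (of_int (sign (\<sigma> \<circ> (\<alpha> \<circ> \<beta>)))) (m (\<sigma> \<circ> (\<alpha> \<circ> \<beta>)) 0 (p + q)))"
    by (intro sum.cong refl summand) auto
  also have "\<dots> = (\<Sum>(\<sigma>, \<alpha>, \<beta>)\<in>shuffle_perms p q \<times> ?A \<times> ?B.
      scale (of_int (sign (\<sigma> \<circ> (\<alpha> \<circ> \<beta>)))) (m (\<sigma> \<circ> (\<alpha> \<circ> \<beta>)) 0 (p + q)))"
    by (simp add: sum.cartesian_product)
  also have "\<dots> = (\<Sum>\<pi> | \<pi> permutes {..<p + q}. scale (of_int (sign \<pi>)) (m \<pi> 0 (p + q)))"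
    using sum.reindex_bij_betw[OF bij_betw_shuffle_block[of p q],
        of "\<lambda>\<pi>. scale (of_int (sign \<pi>)) (m \<pi> 0 (p + q))"]
    by (simp add: case_prod_unfold)
  also have "\<dots> = standard_poly scale (p + q) Ys"
    using assms by (simp add: standard_poly_def m_def)
  finally show ?thesis .
qed

text \<open>By homogeneity only the shuffle sum of degrees \<open>p\<close> and \<open>q\<close>
  survives, and both sides vanish on lists of any other length.\<close>

lemma cross_standard_poly:
  "cross scale (standard_poly scale p) (standard_poly scale q) = standard_poly scale (p + q)"
proof
  fix Ys
  show "cross scale (standard_poly scale p) (standard_poly scale q) Ys = standard_poly scale (p + q) Ys"
    using cross_homogeneous[OF standard_poly_skew standard_poly_skew]
    by (simp add: shuffle_sum_standard_poly standard_poly_def[of _ "p + q"])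
qed

text \<open>Each further factor raises the degree by one. The index is \<open>Suc n\<close> because
  \<open>cross_power\<close> at 0 is still a single factor, by truncated subtraction.\<close>

lemma cross_power_standard_poly_1:
  "cross_power scale (standard_poly scale 1) (Suc n) = standard_poly scale (Suc n)"
proof (induction n)
  case (Suc n)
  have "cross_power scale (standard_poly scale 1) (Suc (Suc n))
      = cross scale (cross_power scale (standard_poly scale 1) (Suc n)) (standard_poly scale 1)"
    \<comment> \<open>The new factor is moved to the end of the list, where \<open>foldl\<close>
      multiplies it last.\<close>
    unfolding cross_power_def diff_Suc_1 replicate_Suc replicate_append_same[symmetric] foldl_append
    by simp
  then show ?case by (simp only: Suc cross_standard_poly) simp
qed (simp add: cross_power_def)

end

theorem corollary4p3p2:
  fixes scale :: "complex \<Rightarrow> 'g \<Rightarrow> 'g::{ring, monoid_mult}"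
  assumes "complex_unital_algebra scale"
  shows "(\<forall>k\<ge>1. standard_poly scale k = cross_power scale (standard_poly scale 1) k) \<and>
    (\<forall>k l. cross scale (standard_poly scale k) (standard_poly scale l) = standard_poly scale (k + l) \<and>
           cross scale (standard_poly scale l) (standard_poly scale k) = standard_poly scale (k + l))"
proof -
  interpret complex_unital_algebra scale by fact
  have "standard_poly scale k = cross_power scale (standard_poly scale 1) k" if "k \<ge> 1" for k
    using that cross_power_standard_poly_1 by (cases k) simp_all
  \<comment> \<open>Commutativity reduces to that of adding degrees.\<close>
  moreover have "cross scale (standard_poly scale l) (standard_poly scale k) = standard_poly scale (k + l)"
    for k l
    by (simp only: cross_standard_poly add.commute)
  ultimately show ?thesis using cross_standard_poly by blast
qed

end
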